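(* Let $f:\mathcal E\to[0,\infty]$ be concave and upper semicontinuous with $S_0:=\operatorname{cl}(\operatorname{dom} f)$ bounded, i.e. $D_0:=D(S_0)<\infty$; let $S_1,\dots,S_m\subseteq\mathcal E$ be closed and convex and $\mathcal S:=\bigcap_{j=1}^m S_j$; let $\varphi_{\mathcal S}$ be a convex identifier of $\mathcal S$ and let $e_0\in\operatorname{int}S_0$, with $R_0:=R_{e_0}(S_0)>0$. Suppose there exist $x^*\in\mathcal S$ with $f(x^* )=p^*>0$ and $x_{SL}\in\operatorname{int}\mathcal S\cap\operatorname{dom}f$ such that $\eta:=(1-\gamma_{S_0,e_0}(x^* ))(1-\varphi_{\mathcal S}(x_{SL}))>0$. Here $p^*=\max_{x\in\mathcal S}f(x)$ and $d^*=\min_{y\in\mathcal E}\Phi(y)$. If $1-d^*\ge0$, then $$p^*-1\ \ge\ \frac{R_0}{D_0+R_0}\cdot\frac{1-d^*}{d^*}.$$ In fact, if $y\in\mathcal S$ satisfies $f^{\Gamma,e_0}(y)\le1$, then $$f(y)-1\ \ge\ \frac{R_0}{D_0+R_0}\cdot\frac{1-f^{\Gamma,e_0}(y)}{f^{\Gamma,e_0}(y)}.$$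
   Context: $\mathcal E$ is a finite-dimensional Euclidean space with inner product $\langle\cdot,\cdot\rangle$ and induced norm $\|\cdot\|$. For $f:\mathcal E\to[0,\infty]$: $\operatorname{dom}f=\{x: 0<f(x)<\infty\}$, $\operatorname{hypo}f=\{(x,u)\in\mathcal E\times(0,\infty): f(x)\ge u\}$, and $f$ is concave if $\operatorname{hypo}f$ is convex. For a set $S$ and $e\in S$: $\gamma_{S,e}(x)=\inf\{v>0: e+\frac{x-e}{v}\in S\}$ (gauge), $R_e(S)=\inf\{\|x-e\|: x\notin S\}$, $D(S)=\sup\{\|x-y\|: x,y\in S\}$. For $e\in\mathcal E$ the radial transform is $f^{\Gamma,e}(y)=\sup\{v>0: v f(e+\frac{y-e}{v})\le1\}$, with $\sup\emptyset=0$. A convex identifier of $\mathcal S$ is a lower semicontinuous convex function $\varphi_{\mathcal S}:\mathcal E\to\mathbb R$ with $\operatorname{int}\mathcal S=\{x:\varphi_{\mathcal S}(x)<1\}$. The multiradial dual function is $\Phi(y)=\max\{f^{\Gamma,e_0}(y),\varphi_{\mathcal S}(y)\}$. *)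

theory Defs
  imports "HOL-Analysis.Analysis"
begin

definition dom_pos :: "('a \<Rightarrow> ennreal) \<Rightarrow> 'a set" where
  "dom_pos f = {x. 0 < f x \<and> f x < \<infinity>}"

definition hypo :: "('a \<Rightarrow> ennreal) \<Rightarrow> ('a \<times> real) set" where
  "hypo f = {(x, u). 0 < u \<and> ennreal u \<le> f x}"

definition concave_ennreal :: "('a::real_vector \<Rightarrow> ennreal) \<Rightarrow> bool" where
  "concave_ennreal f \<longleftrightarrow> convex (hypo f)"

definition upper_semicont :: "('a::topological_space \<Rightarrow> 'b::linorder) \<Rightarrow> bool" where
  "upper_semicont f \<longleftrightarrow> (\<forall>x. \<forall>a. f x < a \<longrightarrow> (\<forall>\<^sub>F y in at x. f y < a))"

definition lower_semicont :: "('a::topological_space \<Rightarrow> 'b::linorder) \<Rightarrow> bool" where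
  "lower_semicont f \<longleftrightarrow> (\<forall>x. \<forall>a. a < f x \<longrightarrow> (\<forall>\<^sub>F y in at x. a < f y))"

(* Extended-real valued, so that the infimum over the empty set is \<infinity>. *)
definition mgauge :: "'a::real_vector set \<Rightarrow> 'a \<Rightarrow> 'a \<Rightarrow> ereal" where
  "mgauge S e x = (INF v\<in>{v::real. 0 < v \<and> e + (x - e) /\<^sub>R v \<in> S}. ereal v)"

(* The supremum is taken in ennreal, where the supremum of the empty set is 0. *)
definition radial :: "'a::real_vector \<Rightarrow> ('a \<Rightarrow> ennreal) \<Rightarrow> 'a \<Rightarrow> ennreal" where
  "radial e f y = (SUP v\<in>{v::real. 0 < v \<and> ennreal v * f (e + (y - e) /\<^sub>R v) \<le> 1}. ennreal v)"

definition convex_identifier :: "'a::euclidean_space set \<Rightarrow> ('a \<Rightarrow> real) \<Rightarrow> bool" where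
  "convex_identifier S \<phi> \<longleftrightarrow>
     lower_semicont \<phi> \<and> convex_on UNIV \<phi> \<and> interior S = {x. \<phi> x < 1}"

definition multiradial_dual ::
  "'a::real_vector \<Rightarrow> ('a \<Rightarrow> ennreal) \<Rightarrow> ('a \<Rightarrow> real) \<Rightarrow> 'a \<Rightarrow> ereal" where
  "multiradial_dual e f \<phi> y = max (enn2ereal (radial e f y)) (ereal (\<phi> y))"

end

theory Submission
  imports Defs
begin

text \<open>
  A bound \<open>radial e f y < v\<close> says that \<open>f\<close> exceeds \<open>1 / v\<close> at the point \<open>e + (y - e) / v\<close>,
  which therefore lies in the bounded set \<open>dom_pos f\<close>. Letting \<open>v\<close> decrease to a value \<open>d \<le> 1\<close> of the
  radial dual, compactness and upper semicontinuity give a point \<open>z\<close> with \<open>f z \<ge> 1 / d\<close> and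
  \<open>y = e + d (z - e)\<close>. Concavity on the segment from \<open>z\<close> through \<open>e\<close> to the boundary of the domain gives
  \<open>f e \<ge> R / (D + R) / d\<close>, and concavity on the segment from \<open>e\<close> to \<open>z\<close> then gives
  \<open>f y \<ge> 1 + (1 - d) f e\<close>. For the optimal value, the same limit is taken along a minimizing
  sequence; its limit point has \<open>\<phi> \<le> 1\<close> and belongs to the constraint set, because \<open>\<phi> < 1\<close> on
  the segment towards \<open>xSL\<close>.
\<close>

section \<open>Semicontinuity along convergent sequences\<close>

lemma upper_semicont_limit:
  fixes f :: "'a::t2_space \<Rightarrow> 'b::{dense_linorder,linorder_topology}"
  assumes f: "upper_semicont f" and X: "X \<longlonglongrightarrow> x" and A: "A \<longlonglongrightarrow> a" and le: "\<And>n. A n \<le> f (X n)"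
  shows "a \<le> f x"
proof (rule ccontr)
  assume "\<not> a \<le> f x"
  then obtain c where c: "f x < c" "c < a" using dense by (meson not_le)
  have "\<forall>\<^sub>F y in at x. f y < c" using f c(1) unfolding upper_semicont_def by blast
  \<comment> \<open>Semicontinuity is stated on punctured neighbourhoods; \<open>x\<close> itself
    may be added since \<open>f x < c\<close>, so terms with \<open>X n = x\<close> do no
    harm.\<close>
  then have "\<forall>\<^sub>F y in nhds x. f y < c"
    unfolding eventually_at_filter by eventually_elim (use c in auto)
  then have "\<forall>\<^sub>F n in sequentially. f (X n) < c" using X by (rule eventually_compose_filterlim)
  moreover have "\<forall>\<^sub>F n in sequentially. c < A n" using A c(2) by (rule order_tendstoD)
  ultimately have "\<forall>\<^sub>F n in sequentially. False"
    by eventually_elim (use le in \<open>meson leD less_le_trans less_trans\<close>)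
  then show False by simp
qed

lemma lower_semicont_limit:
  fixes f :: "'a::t2_space \<Rightarrow> 'b::{dense_linorder,linorder_topology}"
  assumes f: "lower_semicont f" and X: "X \<longlonglongrightarrow> x" and A: "A \<longlonglongrightarrow> a" and le: "\<And>n. f (X n) \<le> A n"
  shows "f x \<le> a"
proof (rule ccontr)
  assume "\<not> f x \<le> a"
  then obtain c where c: "a < c" "c < f x" using dense by (meson not_le)
  have "\<forall>\<^sub>F y in at x. c < f y" using f c(2) unfolding lower_semicont_def by blast
  then have "\<forall>\<^sub>F y in nhds x. c < f y"
    unfolding eventually_at_filter by eventually_elim (use c in auto)
  then have "\<forall>\<^sub>F n in sequentially. c < f (X n)" using X by (rule eventually_compose_filterlim)
  moreover have "\<forall>\<^sub>F n in sequentially. A n < c" using A c(1) by (rule order_tendstoD)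
  ultimately have "\<forall>\<^sub>F n in sequentially. False"
    by eventually_elim (use le in \<open>meson leD le_less_trans less_trans\<close>)
  then show False by simp
qed

section \<open>Concavity through the hypograph\<close>

lemma concave_ennrealD:
  assumes "concave_ennreal f" "ennreal a \<le> f x" "ennreal b \<le> f y" "0 < a" "0 < b"
    and "0 \<le> u" "0 \<le> v" "u + v = 1"
  shows "ennreal (u * a + v * b) \<le> f (u *\<^sub>R x + v *\<^sub>R y)"
proof -
  have "(x, a) \<in> hypo f" "(y, b) \<in> hypo f" using assms by (auto simp: hypo_def)
  then have "u *\<^sub>R (x, a) + v *\<^sub>R (y, b) \<in> hypo f"
    using assms by (intro convexD) (auto simp: concave_ennreal_def)
  then show ?thesis by (auto simp: hypo_def)
qed

lemma ennreal_pos_lower: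
  fixes c :: ennreal
  assumes "0 < c"
  obtains a where "0 < a" "ennreal a \<le> c"
proof (cases c rule: ennreal_cases)
  case (real r)
  then show ?thesis using assms that[of r] by auto
next
  case top
  then show ?thesis using that[of 1] by auto
qed

text \<open>An infinite value at \<open>x\<close> would, by concavity, push \<open>f\<close> above
  every bound on the open segment towards \<open>x0\<close>, and upper semicontinuity would carry
  this to \<open>f x0\<close>. Once all values are finite, \<open>dom_pos f\<close> is simply the
  set where \<open>f\<close> is positive.\<close>

lemma concave_usc_finite:
  fixes f :: "'a::real_normed_vector \<Rightarrow> ennreal"
  assumes cc: "concave_ennreal f" and usc: "upper_semicont f" and x0: "x0 \<in> dom_pos f"
  shows "f x < \<infinity>"
proof (rule ccontr)
  assume "\<not> f x < \<infinity>"
  then have top: "f x = \<infinity>" using top.not_eq_extremum[of "f x"] by auto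
  from x0 have "0 < f x0" and fin: "f x0 < \<infinity>" by (auto simp: dom_pos_def)
  then obtain a where a: "0 < a" "ennreal a \<le> f x0" by (meson ennreal_pos_lower)
  define t where "t n = inverse (real (Suc n))" for n
  have t: "0 < t n" "t n \<le> 1" for n by (auto simp: t_def field_simps)
  have t0: "t \<longlonglongrightarrow> 0" unfolding t_def by (rule LIMSEQ_inverse_real_of_nat)
  have "(\<lambda>n. t n *\<^sub>R x + (1 - t n) *\<^sub>R x0) \<longlonglongrightarrow> 0 *\<^sub>R x + (1 - 0) *\<^sub>R x0"
    by (intro tendsto_intros t0)
  then have lim: "(\<lambda>n. t n *\<^sub>R x + (1 - t n) *\<^sub>R x0) \<longlonglongrightarrow> x0" by simp
  have big: "ennreal b \<le> f (t n *\<^sub>R x + (1 - t n) *\<^sub>R x0)" if "0 < b" for n b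
  proof -
    \<comment> \<open>As \<open>f x\<close> is infinite, the height \<open>b / t n\<close> is
      allowed at \<open>x\<close>; its weight \<open>t n\<close> turns it into
      \<open>b\<close>.\<close>
    have "ennreal b \<le> ennreal (t n * (b / t n) + (1 - t n) * a)"
      using t[of n] a that by (intro ennreal_leI) auto
    also have "\<dots> \<le> f (t n *\<^sub>R x + (1 - t n) *\<^sub>R x0)"
      using t[of n] a that by (intro concave_ennrealD[OF cc]) (auto simp: top)
    finally show ?thesis .
  qed
  obtain b where "0 \<le> b" "f x0 = ennreal b" using fin by (cases "f x0" rule: ennreal_cases) auto
  moreover have "ennreal (b + 1) \<le> f x0"
    using big[of "b + 1"] \<open>0 \<le> b\<close> by (intro upper_semicont_limit[OF usc lim tendsto_const]) auto
  ultimately show False by simp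
qed

lemma convex_dom_pos:
  assumes cc: "concave_ennreal f" and fin: "\<And>x. f x < \<infinity>"
  shows "convex (dom_pos f)"
proof (rule convexI)
  fix x y u v assume xy: "x \<in> dom_pos f" "y \<in> dom_pos f" and uv: "0 \<le> (u::real)" "0 \<le> v" "u + v = 1"
  obtain a where a: "0 < a" "ennreal a \<le> f x" using xy ennreal_pos_lower[of "f x"] by (auto simp: dom_pos_def)
  obtain b where b: "0 < b" "ennreal b \<le> f y" using xy ennreal_pos_lower[of "f y"] by (auto simp: dom_pos_def)
  have "0 < u * a + v * b"
    using a b uv by (cases "u = 0") (auto intro: add_pos_nonneg)
  then have "0 < ennreal (u * a + v * b)" by simp
  also have "\<dots> \<le> f (u *\<^sub>R x + v *\<^sub>R y)" using a b uv by (intro concave_ennrealD[OF cc])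
  finally show "u *\<^sub>R x + v *\<^sub>R y \<in> dom_pos f" using fin by (auto simp: dom_pos_def)
qed

text \<open>\<open>e\<close> lies between \<open>z\<close> and a point nearly \<open>R\<close>
  beyond it where \<open>f\<close> is still positive; the weight of \<open>z\<close> in this
  combination tends to \<open>R / (norm (z - e) + R)\<close>, and \<open>norm (z - e)\<close> is at
  most the diameter.\<close>

lemma concave_center_lower_bound:
  fixes f :: "'a::euclidean_space \<Rightarrow> ennreal"
  assumes cc: "concave_ennreal f" and fin: "\<And>x. f x < \<infinity>" and bd: "bounded (closure (dom_pos f))"
    and R: "0 < R" "R = infdist e (- closure (dom_pos f))" and D: "D = diameter (closure (dom_pos f))"
    and e: "e \<in> closure (dom_pos f)"
    and b: "0 < b" "ennreal b \<le> f z"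
  shows "ennreal (R / (D + R) * b) \<le> f e"
proof -
  let ?S = "closure (dom_pos f)"
  have "0 < ennreal b" using b by simp
  then have "0 < f z" using b(2) by (rule less_le_trans)
  then have "z \<in> dom_pos f" using fin by (simp add: dom_pos_def)
  then have "z \<in> ?S" using closure_subset by blast
  then have nD: "norm (z - e) \<le> D"
    unfolding D using diameter_bounded_bound[OF bd _ e] by (simp add: dist_norm)
  have "?S \<noteq> UNIV" using bd not_bounded_UNIV by metis
  then have ball: "ball e R \<subseteq> ?S"
    using infdist_le[of _ "- ?S" e] R by (force simp: not_le[symmetric])
  \<comment> \<open>A convex set and its closure have the same interior, so the ball avoids the
    boundary points at which \<open>f\<close> may vanish.\<close>
  have "ball e R \<subseteq> dom_pos f"
    using interior_maximal[OF ball open_ball] convex_interior_closure[OF convex_dom_pos[OF cc fin]]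
      interior_subset[of "dom_pos f"] by auto
  then have pos: "0 < f w" if "norm (w - e) < R" for w
    using that by (auto simp: dom_pos_def subset_eq dist_norm norm_minus_commute)
  show ?thesis
  proof (cases "z = e")
    case True
    have "R / (D + R) * b \<le> b" using R nD b True by (auto simp: field_simps)
    then show ?thesis using b True by (metis ennreal_leI order_trans)
  next
    case False
    define n where "n = norm (z - e)"
    have n: "0 < n" "n \<le> D" using False nD by (auto simp: n_def)
    \<comment> \<open>Positivity of \<open>f\<close> is known only on the open ball, hence
      \<open>r < R\<close> first and the limit \<open>r\<close> to \<open>R\<close> from the left
      afterwards.\<close>
    have le: "ennreal (r / (n + r) * b) \<le> f e" if r: "0 < r" "r < R" for r
    proof -
      define w where "w = e - (r / n) *\<^sub>R (z - e)"
      have "norm (w - e) < R" using r n by (simp add: w_def n_def[symmetric])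
      then obtain a where a: "0 < a" "ennreal a \<le> f w" using pos ennreal_pos_lower by metis
      define p where "p = r / (n + r)"
      have pq: "n / (n + r) = 1 - p" "(1 - p) * (r / n) = p"
        using n r by (auto simp: p_def field_simps)
      have "p *\<^sub>R z + (1 - p) *\<^sub>R w = p *\<^sub>R z + (1 - p) *\<^sub>R e - ((1 - p) * (r / n)) *\<^sub>R (z - e)"
        unfolding w_def by (simp only: scaleR_right_diff_distrib scaleR_scaleR add_diff_eq)
      also have "\<dots> = e" unfolding pq by (simp add: algebra_simps)
      finally have we: "(r / (n + r)) *\<^sub>R z + (n / (n + r)) *\<^sub>R w = e" by (simp only: pq p_def)
      \<comment> \<open>The height \<open>a\<close> at \<open>w\<close> is only known to be
        positive, so its contribution is dropped.\<close>
      have "ennreal (r / (n + r) * b) \<le> ennreal (r / (n + r) * b + n / (n + r) * a)"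
        using n r a by (intro ennreal_leI) auto
      also have "\<dots> \<le> f ((r / (n + r)) *\<^sub>R z + (n / (n + r)) *\<^sub>R w)"
        using n r a b by (intro concave_ennrealD[OF cc]) (auto simp flip: add_divide_distrib)
      finally show ?thesis unfolding we .
    qed
    have "((\<lambda>r. ennreal (r / (n + r) * b)) \<longlongrightarrow> ennreal (R / (n + R) * b)) (at_left R)"
      using n R by (intro tendsto_intros tendsto_ennrealI) auto
    moreover have "\<forall>\<^sub>F r in at_left R. ennreal (r / (n + r) * b) \<le> f e"
      using eventually_at_left_real[OF R(1)] by eventually_elim (use le in auto)
    ultimately have "ennreal (R / (n + R) * b) \<le> f e"
      by (rule tendsto_upperbound) simp
    moreover have "R / (D + R) * b \<le> R / (n + R) * b"
      using n R b by (intro mult_right_mono divide_left_mono) auto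
    ultimately show ?thesis by (metis ennreal_leI order_trans)
  qed
qed

lemma concave_segment_growth:
  fixes f :: "'a::real_vector \<Rightarrow> ennreal"
  assumes cc: "concave_ennreal f" and c: "0 < c" "ennreal (c * (1 / d)) \<le> f e"
    and d: "0 < d" "d \<le> 1" and z: "ennreal (1 / d) \<le> f z"
  shows "ennreal (1 + c * ((1 - d) / d)) \<le> f (e + d *\<^sub>R (z - e))"
proof -
  have "ennreal (d * (1 / d) + (1 - d) * (c * (1 / d))) \<le> f (d *\<^sub>R z + (1 - d) *\<^sub>R e)"
    using c d z by (intro concave_ennrealD[OF cc]) auto
  moreover have "d * (1 / d) + (1 - d) * (c * (1 / d)) = 1 + c * ((1 - d) / d)"
    using d by (simp add: field_simps)
  moreover have "d *\<^sub>R z + (1 - d) *\<^sub>R e = e + d *\<^sub>R (z - e)" by (simp add: algebra_simps)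
  ultimately show ?thesis by simp
qed

section \<open>The radial transform and its limits\<close>

text \<open>A number above the supremum is outside the set over which it is taken, so the inequality
  defining that set fails at \<open>v\<close>.\<close>

lemma radial_less_imp:
  assumes "radial e f y < ennreal v"
  shows "0 < v" and "ennreal (1 / v) \<le> f (e + (y - e) /\<^sub>R v)"
proof -
  show v: "0 < v" using assms ennreal_neg[of v] by (metis not_le not_less_zero)
  have "\<not> ennreal v * f (e + (y - e) /\<^sub>R v) \<le> 1"
  proof
    assume "ennreal v * f (e + (y - e) /\<^sub>R v) \<le> 1"
    then have "ennreal v \<le> radial e f y"
      unfolding radial_def using v by (intro SUP_upper) auto
    then show False using assms by simp
  qed
  then have gt: "1 < ennreal v * f (e + (y - e) /\<^sub>R v)" by simp
  show "ennreal (1 / v) \<le> f (e + (y - e) /\<^sub>R v)"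
  proof (cases "f (e + (y - e) /\<^sub>R v)" rule: ennreal_cases)
    case (real r)
    have "ennreal 1 < ennreal (v * r)" using gt real v by (simp add: ennreal_mult)
    then have "1 < v * r" using ennreal_less_iff[of 1 "v * r"] by simp
    then show ?thesis unfolding real(2) using v by (intro ennreal_leI) (simp add: field_simps)
  qed simp
qed

text \<open>Covers both claims: a constant sequence \<open>y\<close> gives the pointwise bound, a
  minimizing sequence the bound on the optimal value. Convergence of \<open>y\<close> is not
  assumed; it comes from compactness for the rescaled points \<open>z\<close>.\<close>

lemma radial_dual_limit:
  fixes f :: "'a::euclidean_space \<Rightarrow> ennreal"
  assumes cc: "concave_ennreal f" and usc: "upper_semicont f" and fin: "\<And>x. f x < \<infinity>"
    and bd: "bounded (closure (dom_pos f))"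
    and R: "0 < R" "R = infdist e (- closure (dom_pos f))" and D: "D = diameter (closure (dom_pos f))"
    and e: "e \<in> closure (dom_pos f)"
    and less: "\<And>n. radial e f (y n) < ennreal (v n)" and v: "v \<longlonglongrightarrow> d" and d1: "d \<le> 1"
  obtains r y' where "strict_mono (r :: nat \<Rightarrow> nat)" "(y \<circ> r) \<longlonglongrightarrow> y'" "0 < d"
    "ennreal (1 + R / (D + R) * ((1 - d) / d)) \<le> f y'"
proof -
  note v0 = radial_less_imp(1)[OF less]
  define z where "z n = e + (y n - e) /\<^sub>R v n" for n
  have fz: "ennreal (1 / v n) \<le> f (z n)" for n
    unfolding z_def by (rule radial_less_imp(2)[OF less])
  have "z n \<in> closure (dom_pos f)" for n
  proof -
    have "0 < ennreal (1 / v n)" using v0 by simp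
    then have "0 < f (z n)" using fz by (rule less_le_trans)
    then have "z n \<in> dom_pos f" using fin by (simp add: dom_pos_def)
    then show ?thesis using closure_subset by blast
  qed
  then obtain l r where r: "strict_mono (r :: nat \<Rightarrow> nat)" "(z \<circ> r) \<longlonglongrightarrow> l"
    using bd unfolding compact_closure[symmetric] closure_closure
    by (metis compact_eq_seq_compact_metric compact_closure closure_closure seq_compactE)
  have vr: "(v \<circ> r) \<longlonglongrightarrow> d" using v r(1) by (rule LIMSEQ_subseq_LIMSEQ)
  have yz: "y n = e + v n *\<^sub>R (z n - e)" for n using v0[of n] by (simp add: z_def)
  have "(\<lambda>n. e + (v \<circ> r) n *\<^sub>R ((z \<circ> r) n - e)) \<longlonglongrightarrow> e + d *\<^sub>R (l - e)"
    by (intro tendsto_intros vr r(2))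
  then have yr: "(y \<circ> r) \<longlonglongrightarrow> e + d *\<^sub>R (l - e)" by (simp add: o_def yz[symmetric])
  \<comment> \<open>If \<open>d = 0\<close>, the bounds \<open>1 / v n\<close> on
    \<open>f (z n)\<close> are unbounded along the subsequence, and upper semicontinuity contradicts
    the finiteness of \<open>f l\<close>.\<close>
  have d0: "0 < d"
  proof (rule ccontr)
    assume "\<not> 0 < d"
    moreover have "0 \<le> d" using v v0 by (meson LIMSEQ_le_const less_imp_le)
    ultimately have "v \<longlonglongrightarrow> 0" using v by simp
    obtain b where b: "0 \<le> b" "f l = ennreal b" using fin[of l] by (cases "f l" rule: ennreal_cases) auto
    have "\<forall>\<^sub>F n in sequentially. (v \<circ> r) n < 1 / (b + 1)"
      using b by (intro order_tendstoD(2)[OF LIMSEQ_subseq_LIMSEQ[OF \<open>v \<longlonglongrightarrow> 0\<close> r(1)]]) simp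
    then obtain N where N: "\<And>n. n \<ge> N \<Longrightarrow> v (r n) < 1 / (b + 1)" by (auto simp: eventually_sequentially)
    have "ennreal (b + 1) \<le> f (z (r (n + N)))" for n
    proof -
      have "b + 1 \<le> 1 / v (r (n + N))"
        using N[of "n + N"] v0[of "r (n + N)"] b by (simp add: field_simps)
      then show ?thesis using fz by (metis ennreal_leI order_trans)
    qed
    then have "ennreal (b + 1) \<le> f l"
      using LIMSEQ_ignore_initial_segment[OF r(2), of N]
      by (intro upper_semicont_limit[OF usc _ tendsto_const, of "\<lambda>n. z (r (n + N))" l]) (auto simp: o_def)
    then show False using b by simp
  qed
  have "(\<lambda>n. ennreal (1 / (v \<circ> r) n)) \<longlonglongrightarrow> ennreal (1 / d)"
    using d0 by (intro tendsto_ennrealI tendsto_intros vr) auto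
  then have fl: "ennreal (1 / d) \<le> f l"
    using fz by (intro upper_semicont_limit[OF usc r(2)]) auto
  have "0 \<le> D" unfolding D using bd by (rule diameter_ge_0)
  then have "ennreal (1 + R / (D + R) * ((1 - d) / d)) \<le> f (e + d *\<^sub>R (l - e))"
    using concave_center_lower_bound[OF cc fin bd R D e _ fl] d0 d1 R(1) fl
    by (intro concave_segment_growth[OF cc]) auto
  then show thesis using that r(1) yr d0 by blast
qed

section \<open>The constraint set and its identifier\<close>

text \<open>The identifier describes only the interior, by \<open>\<phi> < 1\<close>. Points with
  \<open>\<phi> y = 1\<close> are reached as limits of points moved slightly towards
  \<open>x\<close>, where convexity makes the inequality strict.\<close>

lemma convex_identifier_sublevel:
  fixes \<phi> :: "'a::euclidean_space \<Rightarrow> real"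
  assumes id: "convex_identifier S \<phi>" and S: "closed S" and x: "x \<in> interior S" and y: "\<phi> y \<le> 1"
  shows "y \<in> S"
proof -
  define t where "t n = inverse (real (Suc n))" for n
  have t: "0 < t n" "t n \<le> 1" for n by (auto simp: t_def field_simps)
  have t0: "t \<longlonglongrightarrow> 0" unfolding t_def by (rule LIMSEQ_inverse_real_of_nat)
  have "(\<lambda>n. (1 - t n) *\<^sub>R y + t n *\<^sub>R x) \<longlonglongrightarrow> (1 - 0) *\<^sub>R y + 0 *\<^sub>R x"
    by (intro tendsto_intros t0)
  then have lim: "(\<lambda>n. (1 - t n) *\<^sub>R y + t n *\<^sub>R x) \<longlonglongrightarrow> y" by simp
  have cv: "convex_on UNIV \<phi>" and int: "interior S = {x. \<phi> x < 1}"
    using id by (auto simp: convex_identifier_def)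
  have "(1 - t n) *\<^sub>R y + t n *\<^sub>R x \<in> S" for n
  proof -
    have "\<phi> ((1 - t n) *\<^sub>R y + t n *\<^sub>R x) \<le> (1 - t n) * \<phi> y + t n * \<phi> x"
      using t[of n] by (intro convex_onD[OF cv]) auto
    also have "\<dots> < (1 - t n) * 1 + t n * 1"
      using t[of n] x y int by (intro add_le_less_mono mult_left_mono mult_strict_left_mono) auto
    finally have "(1 - t n) *\<^sub>R y + t n *\<^sub>R x \<in> interior S" unfolding int by simp
    then show ?thesis using interior_subset by blast
  qed
  then show ?thesis using S lim by (meson closed_sequentially)
qed

section \<open>From \<open>ennreal\<close> bounds to the extended real inequalities\<close>

lemma enn2ereal_minus_one_ge:
  assumes "0 < d" "d \<le> 1" "0 < c" "ennreal (1 + c * ((1 - d) / d)) \<le> p"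
  shows "ereal c * ((1 - ereal d) / ereal d) \<le> enn2ereal p - 1"
proof -
  have "0 \<le> c * ((1 - d) / d)" using assms by simp
  then have "ereal (1 + c * ((1 - d) / d)) = enn2ereal (ennreal (1 + c * ((1 - d) / d)))"
    by (subst enn2ereal_ennreal) auto
  also have "\<dots> \<le> enn2ereal p" using assms(4) by (simp add: less_eq_ennreal.rep_eq)
  finally have "ereal (1 + c * ((1 - d) / d)) - 1 \<le> enn2ereal p - 1" by (rule ereal_minus_mono) simp
  moreover have "ereal (1 + c * ((1 - d) / d)) - 1 = ereal c * ((1 - ereal d) / ereal d)"
    using assms(1) by (simp add: one_ereal_def)
  ultimately show ?thesis by simp
qed

theorem theorem3p4:
  fixes f :: "'a::euclidean_space \<Rightarrow> ennreal"
    and S :: "nat \<Rightarrow> 'a set" and m :: nat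
    and SS S0 :: "'a set"
    and \<phi> :: "'a \<Rightarrow> real"
    and e0 xstar xSL :: 'a
    and R0 D0 :: real
    and pstar :: ennreal and dstar :: ereal
  assumes "concave_ennreal f" and "upper_semicont f"
    and "S0 = closure (dom_pos f)" and "bounded S0" and "D0 = diameter S0"
    and "\<And>j. j \<in> {1..m} \<Longrightarrow> closed (S j) \<and> convex (S j)"
    and "SS = (\<Inter>j\<in>{1..m}. S j)"
    and "convex_identifier SS \<phi>"
    and "e0 \<in> interior S0"
    and "R0 = infdist e0 (- S0)" and "R0 > 0"
    and "xstar \<in> SS" and "f xstar = pstar" and "pstar > 0"
    and "xSL \<in> interior SS \<inter> dom_pos f"
    and "(1 - mgauge S0 e0 xstar) * (1 - ereal (\<phi> xSL)) > 0"
    and "pstar = (SUP x\<in>SS. f x)"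
    and "dstar = (INF y. multiradial_dual e0 f \<phi> y)"
  shows "(1 - dstar \<ge> 0 \<longrightarrow>
            enn2ereal pstar - 1 \<ge> ereal (R0 / (D0 + R0)) * ((1 - dstar) / dstar))
       \<and> (\<forall>y\<in>SS. radial e0 f y \<le> 1 \<longrightarrow>
            enn2ereal (f y) - 1 \<ge>
              ereal (R0 / (D0 + R0)) * ((1 - enn2ereal (radial e0 f y)) / enn2ereal (radial e0 f y)))"
proof -
  note cc = assms(1) and usc = assms(2) and S0 = assms(3)
  have fin: "f x < \<infinity>" for x using concave_usc_finite[OF cc usc, of xSL] assms(15) by auto
  have bd: "bounded (closure (dom_pos f))" using assms(4) S0 by simp
  have R: "0 < R0" "R0 = infdist e0 (- closure (dom_pos f))" using assms(10,11) S0 by auto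
  have D: "D0 = diameter (closure (dom_pos f))" using assms(5) S0 by simp
  have e: "e0 \<in> closure (dom_pos f)" using assms(9) S0 interior_subset by auto
  note limit = radial_dual_limit[OF cc usc fin bd R D e]
  have "0 \<le> D0" unfolding D using bd by (rule diameter_ge_0)
  then have c: "0 < R0 / (D0 + R0)" using R(1) by simp
  \<comment> \<open>A vanishing positive slack, giving the strict bounds on \<open>radial\<close>
    that \<open>limit\<close> requires.\<close>
  define \<delta> where "\<delta> n = inverse (real (Suc n))" for n
  have \<delta>: "0 < \<delta> n" for n by (simp add: \<delta>_def)
  have "(\<lambda>n. d + \<delta> n) \<longlonglongrightarrow> d + 0" for d
    unfolding \<delta>_def by (intro tendsto_intros LIMSEQ_inverse_real_of_nat)
  then have v: "(\<lambda>n. d + \<delta> n) \<longlonglongrightarrow> d" for d by simp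
  have "ereal (R0 / (D0 + R0)) * ((1 - enn2ereal (radial e0 f y)) / enn2ereal (radial e0 f y))
      \<le> enn2ereal (f y) - 1" if le: "radial e0 f y \<le> 1" for y
  proof -
    obtain d where d: "0 \<le> d" "radial e0 f y = ennreal d"
      using le by (cases "radial e0 f y" rule: ennreal_cases) (auto simp: top_unique)
    with le have d1: "d \<le> 1" by simp
    have less: "radial e0 f y < ennreal (d + \<delta> n)" for n
      using d \<delta>[of n] by (simp add: ennreal_less_iff)
    obtain r y' where r: "strict_mono (r :: nat \<Rightarrow> nat)" "((\<lambda>_. y) \<circ> r) \<longlonglongrightarrow> y'" "0 < d"
      "ennreal (1 + R0 / (D0 + R0) * ((1 - d) / d)) \<le> f y'"
      by (rule limit[OF less v d1])
    have "y' = y" using r(2) by (simp add: o_def LIMSEQ_const_iff)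
    then show ?thesis using enn2ereal_minus_one_ge[OF r(3) d1 c] r(4) d by simp
  qed
  moreover have "ereal (R0 / (D0 + R0)) * ((1 - dstar) / dstar) \<le> enn2ereal pstar - 1"
    if "0 \<le> 1 - dstar"
  proof -
    have "0 \<le> dstar"
      unfolding assms(18) multiradial_dual_def by (intro INF_greatest) (simp add: le_max_iff_disj)
    with that obtain d where d: "0 \<le> d" "dstar = ereal d" "d \<le> 1"
      by (cases dstar) (auto simp: one_ereal_def zero_ereal_def)
    \<comment> \<open>A minimizing sequence for the dual; each bound on the maximum splits into one
      on \<open>radial\<close> and one on \<open>\<phi>\<close>.\<close>
    have "\<exists>y. multiradial_dual e0 f \<phi> y < ereal (d + \<delta> n)" for n
      using d \<delta>[of n] by (subst INF_less_iff[of _ UNIV, simplified, symmetric]) (simp flip: assms(18))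
    then obtain y where y: "\<And>n. multiradial_dual e0 f \<phi> (y n) < ereal (d + \<delta> n)" by metis
    have less: "radial e0 f (y n) < ennreal (d + \<delta> n)" for n
    proof -
      have "enn2ereal (ennreal (d + \<delta> n)) = ereal (d + \<delta> n)"
        using d(1) \<delta>[of n] by (intro enn2ereal_ennreal) simp
      then show ?thesis
        using y[of n] unfolding less_ennreal.rep_eq multiradial_dual_def by simp
    qed
    obtain r y' where r: "strict_mono (r :: nat \<Rightarrow> nat)" "(y \<circ> r) \<longlonglongrightarrow> y'" "0 < d"
      "ennreal (1 + R0 / (D0 + R0) * ((1 - d) / d)) \<le> f y'"
      by (rule limit[OF less v d(3)])
    have le: "\<phi> (y n) \<le> d + \<delta> n" for n using y[of n] by (simp add: multiradial_dual_def)
    have "lower_semicont \<phi>" using assms(8) by (simp add: convex_identifier_def)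
    \<comment> \<open>As \<open>d \<le> 1\<close>, this bound at the limit point is what makes it
      feasible, so that \<open>f y'\<close> is at most \<open>pstar\<close>.\<close>
    then have "\<phi> y' \<le> d"
      using r(2) LIMSEQ_subseq_LIMSEQ[OF v r(1)]
      by (rule lower_semicont_limit) (simp add: le)
    moreover have "closed SS" unfolding assms(7) using assms(6) by (intro closed_INT) auto
    ultimately have "y' \<in> SS"
      using convex_identifier_sublevel[OF assms(8), of xSL y'] assms(15) d(3) by auto
    then have "f y' \<le> pstar" unfolding assms(17) by (rule SUP_upper)
    then show ?thesis using enn2ereal_minus_one_ge[OF r(3) d(3) c] r(4) d(2) by simp
  qed
  ultimately show ?thesis by blast
qed

end
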